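(* Let $\mathcal{P}$ be one of the following properties of semigroups: simple, bisimple, completely simple, semisimple, completely semisimple, cryptic, left cryptic, right cryptic. Let $S\in\mathcal{IC}$ be an idempotent covered semigroup. Then $S$ has property $\mathcal{P}$ if and only if $T(S)$ has property $\mathcal{P}$.
   Context: For a semigroup $S$, $E(S)$ denotes its set of idempotents, and $S^1$ denotes $S$ itself if $S$ is a monoid, and otherwise $S$ with an identity $1$ adjoined. $S$ is idempotent covered ($S\in\mathcal{IC}$) if for every $s\in S$ there are $e,f\in E(S)$ with $se=s=fs$. Let $R_2=\{\sigma,\tau\}$ be the two-element right-zero semigroup, and let $T*R_2$ be the set $S\times S\times R_2$ with product $(t_1,s_1,\sigma)(t_2,s_2,\alpha_2)=(t_1s_2,\,s_1s_2,\,\alpha_2)$ and $(t_1,s_1,\tau)(t_2,s_2,\alpha_2)=(t_1t_2,\,s_1t_2,\,\alpha_2)$ (a semidirect product of $T=S\times S$ by $R_2$). Let $E=\{(s,t,\alpha)\in E(T*R_2):\ s\in S^1t\}$ and $T(S)=\langle E\rangle$, the subsemigroup generated by $E$; for $S\in\mathcal{IC}$ one has $T(S)=\{(s,t,\alpha)\in T*R_2: s\in S^1t\}$. A semigroup is simple [bisimple] if it has only one $\mathcal{J}$-class [$\mathcal{D}$-class]. A semigroup with $0$ is $0$-simple if $\{0\}$ and its complement are its only $\mathcal{J}$-classes and it is not a null semigroup. A non-zero idempotent $e$ is primitive if for all idempotents $f$, $ef=fe=f\neq 0$ implies $e=f$. A completely ($0$-)simple semigroup is a ($0$-)simple semigroup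 with a primitive idempotent. For $a\in S$ let $J(a)$ be the principal ideal generated by $a$, $J_a$ its $\mathcal{J}$-class and $I(a)=J(a)\setminus J_a$; the principal factor $J(a)/I(a)\cong J_a\cup\{0\}$ (products falling outside $J_a$ are $0$; this convention is also used when $I(a)=\emptyset$) is either $0$-simple or null. $S$ is semisimple if all its principal factors are $0$-simple, and completely semisimple if all its principal factors are completely $0$-simple. $S$ is cryptic [left cryptic, right cryptic] if Green's relation $\mathcal{H}$ is a congruence [left congruence, right congruence] on $S$. *)

theory Defs
  imports "HOL-Algebra.Congruence"
begin

record 'a sgrp = "'a partial_object" +
  mult :: "'a \<Rightarrow> 'a \<Rightarrow> 'a" (infixl "\<cdot>\<index>" 70)

(* The carrier may be empty, so both conventions on the empty semigroup are covered. *)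
locale sgrp =
  fixes S (structure)
  assumes mult_closed: "\<lbrakk>x \<in> carrier S; y \<in> carrier S\<rbrakk> \<Longrightarrow> x \<cdot> y \<in> carrier S"
    and mult_assoc: "\<lbrakk>x \<in> carrier S; y \<in> carrier S; z \<in> carrier S\<rbrakk>
      \<Longrightarrow> (x \<cdot> y) \<cdot> z = x \<cdot> (y \<cdot> z)"

definition idempotents :: "('a, 'm) sgrp_scheme \<Rightarrow> 'a set" where
  "idempotents S = {e \<in> carrier S. e \<cdot>\<^bsub>S\<^esub> e = e}"

definition idempotent_covered :: "('a, 'm) sgrp_scheme \<Rightarrow> bool" where
  "idempotent_covered S \<longleftrightarrow>
     (\<forall>s\<in>carrier S. \<exists>e\<in>idempotents S. \<exists>f\<in>idempotents S. s \<cdot>\<^bsub>S\<^esub> e = s \<and> f \<cdot>\<^bsub>S\<^esub> s = s)"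

definition has_identity :: "('a, 'm) sgrp_scheme \<Rightarrow> bool" where
  "has_identity S \<longleftrightarrow>
     (\<exists>e\<in>carrier S. \<forall>x\<in>carrier S. e \<cdot>\<^bsub>S\<^esub> x = x \<and> x \<cdot>\<^bsub>S\<^esub> e = x)"

(* The semigroup written as S with superscript 1. The element Some a stands for a in S;
   None is the adjoined identity and belongs to the carrier only if S is not a monoid. *)
definition with_one :: "('a, 'm) sgrp_scheme \<Rightarrow> 'a option sgrp" where
  "with_one S =
     \<lparr>carrier = (if has_identity S then Some ` carrier S else insert None (Some ` carrier S)),
      mult = (\<lambda>x y. case x of None \<Rightarrow> y
                | Some a \<Rightarrow> (case y of None \<Rightarrow> x | Some b \<Rightarrow> Some (a \<cdot>\<^bsub>S\<^esub> b)))\<rparr>"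

definition left_ideal :: "('a, 'm) sgrp_scheme \<Rightarrow> 'a \<Rightarrow> 'a set" where
  "left_ideal S a = {b. \<exists>x\<in>carrier (with_one S). Some b = x \<cdot>\<^bsub>with_one S\<^esub> Some a}"

definition right_ideal :: "('a, 'm) sgrp_scheme \<Rightarrow> 'a \<Rightarrow> 'a set" where
  "right_ideal S a = {b. \<exists>x\<in>carrier (with_one S). Some b = Some a \<cdot>\<^bsub>with_one S\<^esub> x}"

definition principal_ideal :: "('a, 'm) sgrp_scheme \<Rightarrow> 'a \<Rightarrow> 'a set" where
  "principal_ideal S a = {b. \<exists>x\<in>carrier (with_one S). \<exists>y\<in>carrier (with_one S).
     Some b = (x \<cdot>\<^bsub>with_one S\<^esub> Some a) \<cdot>\<^bsub>with_one S\<^esub> y}"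

definition green_L :: "('a, 'm) sgrp_scheme \<Rightarrow> 'a rel" where
  "green_L S = {(a, b). a \<in> carrier S \<and> b \<in> carrier S \<and> left_ideal S a = left_ideal S b}"

definition green_R :: "('a, 'm) sgrp_scheme \<Rightarrow> 'a rel" where
  "green_R S = {(a, b). a \<in> carrier S \<and> b \<in> carrier S \<and> right_ideal S a = right_ideal S b}"

definition green_J :: "('a, 'm) sgrp_scheme \<Rightarrow> 'a rel" where
  "green_J S = {(a, b). a \<in> carrier S \<and> b \<in> carrier S
     \<and> principal_ideal S a = principal_ideal S b}"

definition green_H :: "('a, 'm) sgrp_scheme \<Rightarrow> 'a rel" where
  "green_H S = green_L S \<inter> green_R S"

definition green_D :: "('a, 'm) sgrp_scheme \<Rightarrow> 'a rel" where
  "green_D S = green_L S O green_R S"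

(* As usual, the sole element of a trivial semigroup does not count as a zero; otherwise the
   trivial semigroup would have no primitive idempotent and not be completely simple. *)
definition is_zero :: "('a, 'm) sgrp_scheme \<Rightarrow> 'a \<Rightarrow> bool" where
  "is_zero S z \<longleftrightarrow> z \<in> carrier S \<and> carrier S \<noteq> {z}
     \<and> (\<forall>x\<in>carrier S. z \<cdot>\<^bsub>S\<^esub> x = z \<and> x \<cdot>\<^bsub>S\<^esub> z = z)"

(* In a semigroup without zero the conditions of being non-zero are void. *)
definition primitive_idempotent :: "('a, 'm) sgrp_scheme \<Rightarrow> 'a \<Rightarrow> bool" where
  "primitive_idempotent S e \<longleftrightarrow> e \<in> idempotents S \<and> \<not> is_zero S e
     \<and> (\<forall>f\<in>idempotents S. e \<cdot>\<^bsub>S\<^esub> f = f \<and> f \<cdot>\<^bsub>S\<^esub> e = f \<and> \<not> is_zero S f \<longrightarrow> e = f)"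

definition simple_sgrp :: "('a, 'm) sgrp_scheme \<Rightarrow> bool" where
  "simple_sgrp S \<longleftrightarrow> is_singleton (carrier S // green_J S)"

definition bisimple :: "('a, 'm) sgrp_scheme \<Rightarrow> bool" where
  "bisimple S \<longleftrightarrow> is_singleton (carrier S // green_D S)"

definition zero_simple :: "('a, 'm) sgrp_scheme \<Rightarrow> bool" where
  "zero_simple S \<longleftrightarrow> (\<exists>z. is_zero S z
     \<and> carrier S // green_J S = {{z}, carrier S - {z}}
     \<and> \<not> (\<forall>x\<in>carrier S. \<forall>y\<in>carrier S. x \<cdot>\<^bsub>S\<^esub> y = z))"

definition completely_simple :: "('a, 'm) sgrp_scheme \<Rightarrow> bool" where
  "completely_simple S \<longleftrightarrow> simple_sgrp S \<and> (\<exists>e. primitive_idempotent S e)"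

definition completely_zero_simple :: "('a, 'm) sgrp_scheme \<Rightarrow> bool" where
  "completely_zero_simple S \<longleftrightarrow> zero_simple S \<and> (\<exists>e. primitive_idempotent S e)"

definition J_class :: "('a, 'm) sgrp_scheme \<Rightarrow> 'a \<Rightarrow> 'a set" where
  "J_class S a = green_J S `` {a}"

(* The J-class of a with a zero (None) adjoined, also when this J-class is the minimal ideal. *)
definition principal_factor :: "('a, 'm) sgrp_scheme \<Rightarrow> 'a \<Rightarrow> 'a option sgrp" where
  "principal_factor S a =
     \<lparr>carrier = insert None (Some ` J_class S a),
      mult = (\<lambda>x y. case x of None \<Rightarrow> None
                | Some b \<Rightarrow> (case y of None \<Rightarrow> None
                    | Some c \<Rightarrow> if b \<cdot>\<^bsub>S\<^esub> c \<in> J_class S a then Some (b \<cdot>\<^bsub>S\<^esub> c) else None))\<rparr>"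

definition semisimple :: "('a, 'm) sgrp_scheme \<Rightarrow> bool" where
  "semisimple S \<longleftrightarrow> (\<forall>a\<in>carrier S. zero_simple (principal_factor S a))"

definition completely_semisimple :: "('a, 'm) sgrp_scheme \<Rightarrow> bool" where
  "completely_semisimple S \<longleftrightarrow>
     (\<forall>a\<in>carrier S. completely_zero_simple (principal_factor S a))"

definition left_congruence :: "('a, 'm) sgrp_scheme \<Rightarrow> 'a rel \<Rightarrow> bool" where
  "left_congruence S r \<longleftrightarrow> equiv (carrier S) r
     \<and> (\<forall>(a, b)\<in>r. \<forall>c\<in>carrier S. (c \<cdot>\<^bsub>S\<^esub> a, c \<cdot>\<^bsub>S\<^esub> b) \<in> r)"

definition right_congruence :: "('a, 'm) sgrp_scheme \<Rightarrow> 'a rel \<Rightarrow> bool" where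
  "right_congruence S r \<longleftrightarrow> equiv (carrier S) r
     \<and> (\<forall>(a, b)\<in>r. \<forall>c\<in>carrier S. (a \<cdot>\<^bsub>S\<^esub> c, b \<cdot>\<^bsub>S\<^esub> c) \<in> r)"

definition two_sided_congruence :: "('a, 'm) sgrp_scheme \<Rightarrow> 'a rel \<Rightarrow> bool" where
  "two_sided_congruence S r \<longleftrightarrow> equiv (carrier S) r
     \<and> (\<forall>(a, b)\<in>r. \<forall>(c, d)\<in>r. (a \<cdot>\<^bsub>S\<^esub> c, b \<cdot>\<^bsub>S\<^esub> d) \<in> r)"

definition cryptic :: "('a, 'm) sgrp_scheme \<Rightarrow> bool" where
  "cryptic S \<longleftrightarrow> two_sided_congruence S (green_H S)"

definition left_cryptic :: "('a, 'm) sgrp_scheme \<Rightarrow> bool" where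
  "left_cryptic S \<longleftrightarrow> left_congruence S (green_H S)"

definition right_cryptic :: "('a, 'm) sgrp_scheme \<Rightarrow> bool" where
  "right_cryptic S \<longleftrightarrow> right_congruence S (green_H S)"

inductive_set generated :: "('a, 'm) sgrp_scheme \<Rightarrow> 'a set \<Rightarrow> 'a set"
  for S :: "('a, 'm) sgrp_scheme" and A :: "'a set" where
  base: "x \<in> A \<Longrightarrow> x \<in> generated S A"
| step: "\<lbrakk>x \<in> generated S A; y \<in> generated S A\<rbrakk> \<Longrightarrow> x \<cdot>\<^bsub>S\<^esub> y \<in> generated S A"

datatype R2 = Sigma | Tau

fun TR2_mult :: "('a, 'm) sgrp_scheme \<Rightarrow> 'a \<times> 'a \<times> R2 \<Rightarrow> 'a \<times> 'a \<times> R2 \<Rightarrow> 'a \<times> 'a \<times> R2" where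
  "TR2_mult S (t1, s1, Sigma) (t2, s2, \<alpha>2) = (t1 \<cdot>\<^bsub>S\<^esub> s2, s1 \<cdot>\<^bsub>S\<^esub> s2, \<alpha>2)"
| "TR2_mult S (t1, s1, Tau) (t2, s2, \<alpha>2) = (t1 \<cdot>\<^bsub>S\<^esub> t2, s1 \<cdot>\<^bsub>S\<^esub> t2, \<alpha>2)"

definition TR2 :: "('a, 'm) sgrp_scheme \<Rightarrow> ('a \<times> 'a \<times> R2) sgrp" where
  "TR2 S = \<lparr>carrier = carrier S \<times> carrier S \<times> UNIV, mult = TR2_mult S\<rparr>"

definition T_gens :: "('a, 'm) sgrp_scheme \<Rightarrow> ('a \<times> 'a \<times> R2) set" where
  "T_gens S = {(s, t, \<alpha>). (s, t, \<alpha>) \<in> idempotents (TR2 S) \<and> s \<in> left_ideal S t}"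

definition T_sgrp :: "('a, 'm) sgrp_scheme \<Rightarrow> ('a \<times> 'a \<times> R2) sgrp" where
  "T_sgrp S = \<lparr>carrier = generated (TR2 S) (T_gens S), mult = TR2_mult S\<rparr>"

end

theory Submission
  imports Defs
begin

text \<open>
  Since \<open>S\<close> is idempotent covered, \<open>S\<^sup>1 t = S t\<close>, and \<open>T(S)\<close> is the set of all triples
  \<open>(u t, t, \<alpha>)\<close> with \<open>u, t \<in> S\<close>. This semigroup is again idempotent covered, so in both
  semigroups the adjoined identity may be dropped from the definitions of Green's relations. In
  a product \<open>(a, b, \<alpha>) (c, d, \<beta>) = (a x, b x, \<beta>)\<close> the factor \<open>x\<close> is \<open>c\<close> or \<open>d\<close>, and \<open>c \<in> S d\<close>.
  Hence Green's relations on \<open>T(S)\<close> are governed by the middle coordinates: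
  \<open>(s, t, \<alpha>)\<close> and \<open>(s', t', \<beta>)\<close> are related

    \<^item> by \<open>J\<close> or \<open>D\<close> iff \<open>t\<close> and \<open>t'\<close> are;
    \<^item> by \<open>L\<close> iff \<open>t L t'\<close> and \<open>\<alpha> = \<beta>\<close>;
    \<^item> by \<open>R\<close> iff \<open>t R t'\<close> and \<open>s = u t\<close>, \<open>s' = u t'\<close> for a common \<open>u\<close>;
    \<^item> by \<open>H\<close> iff \<open>t H t'\<close>, \<open>\<alpha> = \<beta>\<close> and there is such a common \<open>u\<close>.

  (Lemmas \<open>green_J_T\<close>, \<open>green_D_T\<close>, \<open>green_L_T\<close>, \<open>green_R_T\<close>, \<open>green_H_T\<close>.) So \<open>X \<mapsto> {(s, t, \<alpha>). t \<in> X}\<close>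
  is a bijection between the \<open>J\<close>-classes (or \<open>D\<close>-classes) of \<open>S\<close> and those of \<open>T(S)\<close>, which
  settles simplicity and bisimplicity. The properties of principal factors become statements about
  single \<open>J\<close>-classes: a factor is \<open>0\<close>-simple iff its class contains \<open>x\<close>, \<open>y\<close> and \<open>x y\<close>
  for some \<open>x, y\<close>, and completely \<open>0\<close>-simple iff its class contains an idempotent that is minimal
  among the idempotents of the class. Both conditions pass between a class and its counterpart:
  from \<open>S\<close> to \<open>T(S)\<close> along the diagonal \<open>t \<mapsto> (t, t, \<sigma>)\<close>, and back by
  examining coordinates (\<open>semisimple_T\<close>, \<open>primitive_in_T\<close>). Finally, multiplying an \<open>H\<close>-related
  pair of \<open>T(S)\<close> on either side multiplies its middle coordinates by one and the same element of
  \<open>S\<close> and again leaves a common \<open>u\<close>, while \<open>t \<mapsto> (t, t, \<sigma>)\<close> preserves and reflects \<open>H\<close>; this transfers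
  left and right crypticity, and together these amount to crypticity.
\<close>

section \<open>Green's relations in idempotent covered semigroups\<close>

locale ic_sgrp = sgrp +
  assumes covered: "idempotent_covered S"
begin

lemma left_unit:
  assumes "s \<in> carrier S"
  obtains f where "f \<in> carrier S" "f \<cdot> f = f" "f \<cdot> s = s"
  using covered assms unfolding idempotent_covered_def idempotents_def by blast

lemma right_unit:
  assumes "s \<in> carrier S"
  obtains e where "e \<in> carrier S" "e \<cdot> e = e" "s \<cdot> e = s"
  using covered assms unfolding idempotent_covered_def idempotents_def by blast

lemma carrier_with_one:
  "x \<in> carrier S \<Longrightarrow> Some x \<in> carrier (with_one S)"
  "Some x \<in> carrier (with_one S) \<Longrightarrow> x \<in> carrier S"
  by (auto simp: with_one_def split: if_splits)

lemma with_one_mult [simp]: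
  "None \<cdot>\<^bsub>with_one S\<^esub> y = y"
  "x \<cdot>\<^bsub>with_one S\<^esub> None = x"
  "Some a \<cdot>\<^bsub>with_one S\<^esub> Some b = Some (a \<cdot> b)"
  by (auto simp: with_one_def split: option.splits)

text \<open>The adjoined identity contributes only \<open>a\<close> itself, and \<open>a = f a\<close> for some \<open>f\<close> in the semigroup.\<close>

lemma left_ideal_eq:
  assumes a: "a \<in> carrier S"
  shows "left_ideal S a = {x \<cdot> a | x. x \<in> carrier S}"
proof -
  obtain f where f: "f \<in> carrier S" "f \<cdot> a = a" using left_unit a by blast
  have "b \<in> {x \<cdot> a | x. x \<in> carrier S}"
    if "x \<in> carrier (with_one S)" "Some b = x \<cdot>\<^bsub>with_one S\<^esub> Some a" for b x
    using that f by (cases x) (force dest: carrier_with_one(2))+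
  moreover have "x \<cdot> a \<in> left_ideal S a" if "x \<in> carrier S" for x
    unfolding left_ideal_def using carrier_with_one(1)[OF that] by force
  ultimately show ?thesis unfolding left_ideal_def by blast
qed

lemma right_ideal_eq:
  assumes a: "a \<in> carrier S"
  shows "right_ideal S a = {a \<cdot> x | x. x \<in> carrier S}"
proof -
  obtain f where f: "f \<in> carrier S" "a \<cdot> f = a" using right_unit a by blast
  have "b \<in> {a \<cdot> x | x. x \<in> carrier S}"
    if "x \<in> carrier (with_one S)" "Some b = Some a \<cdot>\<^bsub>with_one S\<^esub> x" for b x
    using that f by (cases x) (force dest: carrier_with_one(2))+
  moreover have "a \<cdot> x \<in> right_ideal S a" if "x \<in> carrier S" for x
    unfolding right_ideal_def using carrier_with_one(1)[OF that] by force
  ultimately show ?thesis unfolding right_ideal_def by blast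
qed

lemma principal_ideal_eq:
  assumes a: "a \<in> carrier S"
  shows "principal_ideal S a = {x \<cdot> a \<cdot> y | x y. x \<in> carrier S \<and> y \<in> carrier S}"
proof -
  obtain f where f: "f \<in> carrier S" "f \<cdot> a = a" using left_unit a by blast
  obtain e where e: "e \<in> carrier S" "a \<cdot> e = a" using right_unit a by blast
  have "b \<in> {x \<cdot> a \<cdot> y | x y. x \<in> carrier S \<and> y \<in> carrier S}"
    if xy: "x \<in> carrier (with_one S)" "y \<in> carrier (with_one S)"
      "Some b = (x \<cdot>\<^bsub>with_one S\<^esub> Some a) \<cdot>\<^bsub>with_one S\<^esub> y" for b x y
  proof -
    obtain x' where x': "x' \<in> carrier S" "x \<cdot>\<^bsub>with_one S\<^esub> Some a = Some (x' \<cdot> a)"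
      using xy(1) f by (cases x) (auto dest: carrier_with_one(2))
    have "x' \<cdot> a \<cdot> e = x' \<cdot> a" using x' a e by (simp add: mult_assoc)
    then obtain y' where "y' \<in> carrier S" "b = x' \<cdot> a \<cdot> y'"
      using xy(2,3) x' e by (cases y) (force dest: carrier_with_one(2))+
    then show ?thesis using x' by blast
  qed
  moreover have "x \<cdot> a \<cdot> y \<in> principal_ideal S a"
    if "x \<in> carrier S" "y \<in> carrier S" for x y
    unfolding principal_ideal_def
    using carrier_with_one(1)[OF that(1)] carrier_with_one(1)[OF that(2)] by force
  ultimately show ?thesis unfolding principal_ideal_def by blast
qed

lemma green_L_iff:
  "(a, b) \<in> green_L S \<longleftrightarrow> a \<in> carrier S \<and> b \<in> carrier S
     \<and> (\<exists>x\<in>carrier S. a = x \<cdot> b) \<and> (\<exists>y\<in>carrier S. b = y \<cdot> a)" (is "?l \<longleftrightarrow> ?r")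
proof
  assume l: ?l
  then have ab: "a \<in> carrier S" "b \<in> carrier S" and eq: "left_ideal S a = left_ideal S b"
    by (auto simp: green_L_def)
  have "a \<in> left_ideal S a" "b \<in> left_ideal S b"
    using ab by (auto simp: left_ideal_eq) (metis left_unit)+
  then show ?r using ab eq by (auto simp: left_ideal_eq)
next
  assume r: ?r
  then obtain x y where xy: "x \<in> carrier S" "a = x \<cdot> b" "y \<in> carrier S" "b = y \<cdot> a"
    and ab: "a \<in> carrier S" "b \<in> carrier S" by blast
  have "u \<cdot> a = (u \<cdot> x) \<cdot> b" "u \<cdot> b = (u \<cdot> y) \<cdot> a" if "u \<in> carrier S" for u
    using mult_assoc[of u x b] mult_assoc[of u y a] xy ab that by metis+
  then have "left_ideal S a = left_ideal S b"
    unfolding left_ideal_eq[OF ab(1)] left_ideal_eq[OF ab(2)]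
    using mult_closed xy(1,3) by blast
  then show ?l using ab by (simp add: green_L_def)
qed

lemma green_R_iff:
  "(a, b) \<in> green_R S \<longleftrightarrow> a \<in> carrier S \<and> b \<in> carrier S
     \<and> (\<exists>x\<in>carrier S. a = b \<cdot> x) \<and> (\<exists>y\<in>carrier S. b = a \<cdot> y)" (is "?l \<longleftrightarrow> ?r")
proof
  assume l: ?l
  then have ab: "a \<in> carrier S" "b \<in> carrier S" and eq: "right_ideal S a = right_ideal S b"
    by (auto simp: green_R_def)
  have "a \<in> right_ideal S a" "b \<in> right_ideal S b"
    using ab by (auto simp: right_ideal_eq) (metis right_unit)+
  then show ?r using ab eq by (auto simp: right_ideal_eq)
next
  assume r: ?r
  then obtain x y where xy: "x \<in> carrier S" "a = b \<cdot> x" "y \<in> carrier S" "b = a \<cdot> y"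
    and ab: "a \<in> carrier S" "b \<in> carrier S" by blast
  have "a \<cdot> u = b \<cdot> (x \<cdot> u)" "b \<cdot> u = a \<cdot> (y \<cdot> u)" if "u \<in> carrier S" for u
    using mult_assoc[of b x u] mult_assoc[of a y u] xy ab that by metis+
  then have "right_ideal S a = right_ideal S b"
    unfolding right_ideal_eq[OF ab(1)] right_ideal_eq[OF ab(2)]
    using mult_closed xy(1,3) by blast
  then show ?l using ab by (simp add: green_R_def)
qed

lemma principal_ideal_refl: "a \<in> carrier S \<Longrightarrow> a \<in> principal_ideal S a"
  by (simp add: principal_ideal_eq) (metis left_unit right_unit)

lemma principal_ideal_closed:
  assumes "b \<in> carrier S" "a \<in> principal_ideal S b" "u \<in> carrier S"
  shows "a \<in> carrier S" "u \<cdot> a \<in> principal_ideal S b" "a \<cdot> u \<in> principal_ideal S b"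
proof -
  obtain x y where xy: "x \<in> carrier S" "y \<in> carrier S" "a = x \<cdot> b \<cdot> y"
    using assms principal_ideal_eq by auto
  then show "a \<in> carrier S" using assms mult_closed by simp
  have "u \<cdot> a = (u \<cdot> x) \<cdot> b \<cdot> y" "a \<cdot> u = x \<cdot> b \<cdot> (y \<cdot> u)"
    using assms xy by (simp_all add: mult_assoc mult_closed)
  then show "u \<cdot> a \<in> principal_ideal S b" "a \<cdot> u \<in> principal_ideal S b"
    using assms xy mult_closed principal_ideal_eq by blast+
qed

lemma principal_ideal_mono:
  assumes "b \<in> carrier S" "a \<in> principal_ideal S b"
  shows "principal_ideal S a \<subseteq> principal_ideal S b"
proof
  fix c assume "c \<in> principal_ideal S a"
  then obtain x y where "x \<in> carrier S" "y \<in> carrier S" "c = x \<cdot> a \<cdot> y"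
    using principal_ideal_eq[OF principal_ideal_closed(1)[OF assms assms(1)]] by blast
  then show "c \<in> principal_ideal S b"
    using assms principal_ideal_closed(2,3) by blast
qed

lemma green_J_iff:
  "(a, b) \<in> green_J S \<longleftrightarrow> a \<in> carrier S \<and> b \<in> carrier S
     \<and> a \<in> principal_ideal S b \<and> b \<in> principal_ideal S a"
  unfolding green_J_def using principal_ideal_refl principal_ideal_mono by blast

lemma green_L_subset_J: "green_L S \<subseteq> green_J S"
proof -
  have "a \<in> principal_ideal S b" if "b \<in> carrier S" "x \<in> carrier S" "a = x \<cdot> b" for a b x
    using that principal_ideal_closed(2) principal_ideal_refl by blast
  then have "(a, b) \<in> green_J S" if "(a, b) \<in> green_L S" for a b
    using that unfolding green_L_iff green_J_iff by blast
  then show ?thesis by auto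
qed

lemma equiv_green_H: "equiv (carrier S) (green_H S)"
  by (auto simp: green_H_def green_L_def green_R_def equiv_def refl_on_def sym_def trans_def)

lemma green_H_carrier: "(a, b) \<in> green_H S \<Longrightarrow> a \<in> carrier S \<and> b \<in> carrier S"
  by (simp add: green_H_def green_L_def)

section \<open>Principal factors\<close>

lemma mem_J_class: "b \<in> J_class S a \<longleftrightarrow> (a, b) \<in> green_J S"
  by (auto simp: J_class_def)

text \<open>All members of a \<open>J\<close>-class generate the same principal ideal, and that of \<open>b\<close> is squeezed between
  those of \<open>d\<close> and \<open>c\<close>.\<close>

lemma J_class_divisor:
  assumes "a \<in> carrier S" "b \<in> carrier S" "c \<in> J_class S a" "d \<in> J_class S a"
    "b \<in> principal_ideal S c" "d \<in> principal_ideal S b"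
  shows "b \<in> J_class S a"
proof -
  have "c \<in> carrier S" "d \<in> carrier S" "principal_ideal S c = principal_ideal S a"
    "principal_ideal S d = principal_ideal S a"
    using assms(3,4) by (auto simp: mem_J_class green_J_def)
  then show ?thesis
    using principal_ideal_mono[of c b] principal_ideal_mono[of b d] assms
    by (auto simp: mem_J_class green_J_def)
qed

lemma principal_factor_mult [simp]:
  "None \<cdot>\<^bsub>principal_factor S a\<^esub> y = None"
  "x \<cdot>\<^bsub>principal_factor S a\<^esub> None = None"
  "Some b \<cdot>\<^bsub>principal_factor S a\<^esub> Some c
     = (if b \<cdot> c \<in> J_class S a then Some (b \<cdot> c) else None)"
  by (auto simp: principal_factor_def split: option.splits)

lemma carrier_principal_factor:
  "carrier (principal_factor S a) = insert None (Some ` J_class S a)"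
  by (simp add: principal_factor_def)

lemma is_zero_principal_factor:
  assumes "a \<in> carrier S"
  shows "is_zero (principal_factor S a) z \<longleftrightarrow> z = None"
proof -
  have "a \<in> J_class S a" using assms principal_ideal_refl by (simp add: mem_J_class green_J_iff)
  then have "is_zero (principal_factor S a) None"
    by (auto simp: is_zero_def carrier_principal_factor)
  moreover have "z = None" if "is_zero (principal_factor S a) z"
    using that unfolding is_zero_def carrier_principal_factor
    by (metis insertI1 principal_factor_mult(1))
  ultimately show ?thesis by blast
qed

text \<open>The reason why a principal factor is either null or \<open>0\<close>-simple. A product of two members of the
  class \<open>J\<close> inside \<open>J\<close> lets every member of \<open>J\<close> be split into two, hence three, members of \<open>J\<close>.
  Writing \<open>b = m n q\<close> this way and \<open>n = r c s\<close>, the multipliers \<open>m r\<close> and \<open>s q\<close> around \<open>c\<close> divide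
  \<open>b\<close> and are multiples of \<open>m\<close> and \<open>q\<close>, so they are in \<open>J\<close> too.\<close>

lemma J_class_sandwich:
  assumes a: "a \<in> carrier S" and x: "x \<in> J_class S a" and y: "y \<in> J_class S a"
    and xy: "x \<cdot> y \<in> J_class S a" and b: "b \<in> J_class S a" and c: "c \<in> J_class S a"
  obtains u v where "u \<in> J_class S a" "v \<in> J_class S a" "u \<cdot> c \<in> J_class S a" "b = u \<cdot> c \<cdot> v"
proof -
  have car: "d \<in> carrier S" if "d \<in> J_class S a" for d
    using that by (auto simp: mem_J_class green_J_def)
  have below: "d \<in> principal_ideal S e" if "d \<in> J_class S a" "e \<in> J_class S a" for d e
    using that principal_ideal_refl by (auto simp: mem_J_class green_J_def)
  \<comment> \<open>Being above \<open>p q\<close> and below \<open>r\<close> or \<open>s\<close>, the left factor \<open>p\<close> is in the class.\<close>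
  have left: "p \<in> J_class S a" if "p \<in> carrier S" "q \<in> carrier S" "p \<cdot> q \<in> J_class S a"
      "p = r \<cdot> s" "r \<in> carrier S" "s \<in> carrier S" "r \<in> J_class S a \<or> s \<in> J_class S a" for p q r s
    using that J_class_divisor[of a p r "p \<cdot> q"] J_class_divisor[of a p s "p \<cdot> q"]
      principal_ideal_closed(2,3) principal_ideal_refl a by metis
  have right: "q \<in> J_class S a" if "p \<in> carrier S" "q \<in> carrier S" "p \<cdot> q \<in> J_class S a"
      "q = r \<cdot> s" "r \<in> carrier S" "s \<in> carrier S" "r \<in> J_class S a \<or> s \<in> J_class S a" for p q r s
    using that J_class_divisor[of a q r "p \<cdot> q"] J_class_divisor[of a q s "p \<cdot> q"]
      principal_ideal_closed(2,3) principal_ideal_refl a by metis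
  have split: "\<exists>p\<in>J_class S a. \<exists>q\<in>J_class S a. d = p \<cdot> q" if d: "d \<in> J_class S a" for d
  proof -
    obtain r s where rs: "r \<in> carrier S" "s \<in> carrier S" "d = r \<cdot> (x \<cdot> y) \<cdot> s"
      using below[OF d xy] principal_ideal_eq car xy by auto
    then have eq: "d = (r \<cdot> x) \<cdot> (y \<cdot> s)"
      using car x y by (simp add: mult_assoc mult_closed)
    have "r \<cdot> x \<in> J_class S a" "y \<cdot> s \<in> J_class S a"
      using left[of "r \<cdot> x" "y \<cdot> s" r x] right[of "r \<cdot> x" "y \<cdot> s" y s] d eq rs x y car
      by (auto simp: mult_closed)
    then show ?thesis using eq by blast
  qed
  obtain p q where pq: "p \<in> J_class S a" "q \<in> J_class S a" "b = p \<cdot> q" using split[OF b] by blast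
  obtain m n where mn: "m \<in> J_class S a" "n \<in> J_class S a" "p = m \<cdot> n" using split[OF pq(1)] by blast
  obtain r s where rs: "r \<in> carrier S" "s \<in> carrier S" "n = r \<cdot> c \<cdot> s"
    using below[OF mn(2) c] principal_ideal_eq car c by auto
  note cs = car[OF c] car[OF pq(2)] car[OF mn(1)] rs(1,2)
  have eq: "b = (m \<cdot> r) \<cdot> c \<cdot> (s \<cdot> q)" "b = (m \<cdot> r) \<cdot> (c \<cdot> (s \<cdot> q))"
    using cs pq mn rs by (simp_all add: mult_assoc mult_closed)
  have "m \<cdot> r \<in> J_class S a"
    using left[of "m \<cdot> r" "c \<cdot> (s \<cdot> q)" m r] eq(2) b mn cs by (auto simp: mult_closed)
  moreover have "s \<cdot> q \<in> J_class S a" "m \<cdot> r \<cdot> c \<in> J_class S a"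
    using right[of "m \<cdot> r \<cdot> c" "s \<cdot> q" s q] left[of "m \<cdot> r \<cdot> c" "s \<cdot> q" "m \<cdot> r" c] eq(1) b pq c cs
    by (auto simp: mult_closed)
  ultimately show ?thesis using eq(1) that by blast
qed

text \<open>If some product stays in the class, then by \<open>J_class_sandwich\<close> every non-zero element of the
  factor generates the whole factor as an ideal, with multipliers taken from the factor itself.\<close>

lemma zero_simple_principal_factor_iff:
  assumes a: "a \<in> carrier S"
  shows "zero_simple (principal_factor S a) \<longleftrightarrow>
    (\<exists>x\<in>J_class S a. \<exists>y\<in>J_class S a. x \<cdot> y \<in> J_class S a)" (is "zero_simple ?P \<longleftrightarrow> ?r")
proof
  assume "zero_simple ?P"
  then obtain x y where "x \<in> carrier ?P" "y \<in> carrier ?P" "x \<cdot>\<^bsub>?P\<^esub> y \<noteq> None"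
    using a by (auto simp: zero_simple_def is_zero_principal_factor)
  then show ?r by (auto simp: carrier_principal_factor split: if_splits) blast
next
  assume ?r
  then obtain x y where x: "x \<in> J_class S a" and y: "y \<in> J_class S a" and xy: "x \<cdot> y \<in> J_class S a"
    by blast
  have one: "p \<in> carrier (with_one ?P)" if "p \<in> Some ` carrier ?P" for p
    using that by (auto simp: with_one_def)
  have mult: "None \<cdot>\<^bsub>with_one ?P\<^esub> q = q" "q \<cdot>\<^bsub>with_one ?P\<^esub> None = q"
    "Some r \<cdot>\<^bsub>with_one ?P\<^esub> Some s = Some (r \<cdot>\<^bsub>?P\<^esub> s)" for q r s
    by (auto simp: with_one_def split: option.splits)
  have ideal_None: "principal_ideal ?P None = {None}"
  proof -
    have "b = None" if "Some b = (p \<cdot>\<^bsub>with_one ?P\<^esub> Some None) \<cdot>\<^bsub>with_one ?P\<^esub> q" for b p q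
      using that by (cases p; cases q) (auto simp: mult)
    moreover have "None \<in> principal_ideal ?P None"
      unfolding principal_ideal_def using one[of "Some None"]
      by (auto simp: carrier_principal_factor mult intro!: bexI[of _ "Some None"])
    ultimately show ?thesis unfolding principal_ideal_def by blast
  qed
  have ideal_Some: "carrier ?P \<subseteq> principal_ideal ?P (Some c)" if c: "c \<in> J_class S a" for c
  proof
    fix b assume "b \<in> carrier ?P"
    then consider "b = None" | d where "b = Some d" "d \<in> J_class S a"
      by (auto simp: carrier_principal_factor)
    then obtain u v where "u \<in> carrier ?P" "v \<in> carrier ?P" "b = (u \<cdot>\<^bsub>?P\<^esub> Some c) \<cdot>\<^bsub>?P\<^esub> v"
    proof cases
      case 1
      then show ?thesis using that[of None None] by (auto simp: carrier_principal_factor)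
    next
      case (2 d)
      obtain u v where "u \<in> J_class S a" "v \<in> J_class S a" "u \<cdot> c \<in> J_class S a" "d = u \<cdot> c \<cdot> v"
        using J_class_sandwich[OF a x y xy 2(2) c] .
      then show ?thesis using that[of "Some u" "Some v"] 2 by (auto simp: carrier_principal_factor)
    qed
    then show "b \<in> principal_ideal ?P (Some c)"
      unfolding principal_ideal_def
      by (intro CollectI bexI[of _ "Some u"] bexI[of _ "Some v"]) (auto simp: mult one)
  qed
  have closed: "u \<cdot>\<^bsub>?P\<^esub> v \<in> carrier ?P" for u v
    by (cases u; cases v) (auto simp: carrier_principal_factor)
  have ideal_sub: "principal_ideal ?P c \<subseteq> carrier ?P" if "c \<in> carrier ?P" for c
  proof
    fix b assume "b \<in> principal_ideal ?P c"
    then obtain p q where "Some b = (p \<cdot>\<^bsub>with_one ?P\<^esub> Some c) \<cdot>\<^bsub>with_one ?P\<^esub> q"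
      by (auto simp: principal_ideal_def)
    then show "b \<in> carrier ?P" using that closed by (cases p; cases q) (auto simp: mult)
  qed
  have class_None: "green_J ?P `` {None} = {None}"
  proof -
    have "c = None" if "(None, c) \<in> green_J ?P" for c
    proof (rule ccontr)
      assume "c \<noteq> None"
      have "c \<in> carrier ?P" "principal_ideal ?P c = {None}"
        using that by (simp_all add: green_J_def ideal_None)
      with \<open>c \<noteq> None\<close> obtain d where "c = Some d" "d \<in> J_class S a"
        by (auto simp: carrier_principal_factor)
      then show False
        using ideal_Some[of d] \<open>c \<in> carrier ?P\<close> \<open>principal_ideal ?P c = {None}\<close> by auto
    qed
    then show ?thesis by (auto simp: green_J_def carrier_principal_factor)
  qed
  have class_Some: "green_J ?P `` {Some c} = carrier ?P - {None}" if c: "c \<in> J_class S a" for c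
  proof -
    have "principal_ideal ?P (Some d) = carrier ?P" if "d \<in> J_class S a" for d
      using ideal_Some[OF that] ideal_sub[of "Some d"] that by (auto simp: carrier_principal_factor)
    moreover have "(Some c, None) \<notin> green_J ?P"
      using ideal_Some[OF c] c by (auto simp: green_J_def ideal_None carrier_principal_factor)
    ultimately show ?thesis using c by (auto simp: green_J_def carrier_principal_factor)
  qed
  have "carrier ?P // green_J ?P = {{None}, carrier ?P - {None}}"
  proof -
    have "carrier ?P // green_J ?P
        = insert (green_J ?P `` {None}) ((\<lambda>c. green_J ?P `` {Some c}) ` J_class S a)"
      by (auto simp: quotient_def carrier_principal_factor)
    also have "\<dots> = insert {None} ((\<lambda>c. carrier ?P - {None}) ` J_class S a)"
      using class_None class_Some by simp
    also have "\<dots> = {{None}, carrier ?P - {None}}" using x by auto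
    finally show ?thesis .
  qed
  moreover have "Some x \<cdot>\<^bsub>?P\<^esub> Some y \<noteq> None" using xy by simp
  ultimately show "zero_simple ?P"
    unfolding zero_simple_def using x y a
    by (metis carrier_principal_factor is_zero_principal_factor imageI insertI2)
qed

end

text \<open>Minimality among the idempotents of \<open>X\<close> in the natural partial order. For \<open>X\<close> a \<open>J\<close>-class it
  describes the primitive idempotents of the principal factor; for \<open>X\<close> the carrier of a
  semigroup without zero it is primitivity in that semigroup.\<close>

definition primitive_in :: "('a, 'm) sgrp_scheme \<Rightarrow> 'a set \<Rightarrow> 'a \<Rightarrow> bool" where
  "primitive_in S X e \<longleftrightarrow> e \<in> X \<and> e \<cdot>\<^bsub>S\<^esub> e = e
     \<and> (\<forall>f\<in>X. f \<cdot>\<^bsub>S\<^esub> f = f \<longrightarrow> e \<cdot>\<^bsub>S\<^esub> f = f \<longrightarrow> f \<cdot>\<^bsub>S\<^esub> e = f \<longrightarrow> e = f)"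

context ic_sgrp
begin

text \<open>A principal factor is never null once its class contains an idempotent \<open>e\<close>, because \<open>e e = e\<close>;
  so the existence of a primitive idempotent already forces \<open>0\<close>-simplicity.\<close>

lemma completely_zero_simple_principal_factor_iff:
  assumes a: "a \<in> carrier S"
  shows "completely_zero_simple (principal_factor S a) \<longleftrightarrow> (\<exists>e. primitive_in S (J_class S a) e)"
    (is "completely_zero_simple ?P \<longleftrightarrow> _")
proof -
  have idem: "idempotents ?P = insert None (Some ` {g \<in> J_class S a. g \<cdot> g = g})"
    by (auto simp: idempotents_def carrier_principal_factor split: if_splits)
  have below: "Some e \<cdot>\<^bsub>?P\<^esub> Some g = Some g \<longleftrightarrow> e \<cdot> g = g"
    "Some g \<cdot>\<^bsub>?P\<^esub> Some e = Some g \<longleftrightarrow> g \<cdot> e = g"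
    if "g \<in> J_class S a" for e g
    using that by auto
  have "primitive_idempotent ?P (Some e) \<longleftrightarrow> primitive_in S (J_class S a) e" for e
    unfolding primitive_idempotent_def primitive_in_def is_zero_principal_factor[OF a] idem
    by (auto simp del: principal_factor_mult(3) simp: below)
  moreover have "\<not> primitive_idempotent ?P None"
    using a by (simp add: primitive_idempotent_def is_zero_principal_factor)
  ultimately have "(\<exists>e. primitive_idempotent ?P e) \<longleftrightarrow> (\<exists>e. primitive_in S (J_class S a) e)"
    by (metis option.exhaust)
  moreover have "zero_simple ?P" if "primitive_in S (J_class S a) e" for e
    using that unfolding zero_simple_principal_factor_iff[OF a] primitive_in_def by metis
  ultimately show ?thesis by (auto simp: completely_zero_simple_def)
qed

text \<open>A zero would generate the ideal consisting of itself alone, so the single \<open>J\<close>-class would be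
  trivial. Consequently the primitive idempotents of a simple semigroup are those minimal
  among all of its idempotents.\<close>

lemma simple_no_zero:
  assumes "simple_sgrp S"
  shows "\<not> is_zero S z"
proof
  assume z: "is_zero S z"
  then have zc: "z \<in> carrier S" by (simp add: is_zero_def)
  have "principal_ideal S z = {z}"
    using z zc principal_ideal_refl[OF zc] by (auto simp: principal_ideal_eq is_zero_def)
  moreover have "b \<in> principal_ideal S z" if "b \<in> carrier S" for b
  proof -
    have "green_J S `` {z} = green_J S `` {b}"
      using assms zc that quotientI[of _ "carrier S" "green_J S"]
      by (metis simple_sgrp_def is_singletonE singletonD)
    moreover have "(b, b) \<in> green_J S" using that by (simp add: green_J_def)
    ultimately have "(z, b) \<in> green_J S" by blast
    then show ?thesis by (simp add: green_J_iff)
  qed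
  ultimately have "carrier S = {z}"
    using zc by blast
  then show False using z by (simp add: is_zero_def)
qed

lemma completely_simple_iff:
  "completely_simple S \<longleftrightarrow> simple_sgrp S \<and> (\<exists>e. primitive_in S (carrier S) e)"
  using simple_no_zero
  by (auto simp: completely_simple_def primitive_idempotent_def primitive_in_def idempotents_def)

lemma left_cryptic_iff:
  "left_cryptic S \<longleftrightarrow> (\<forall>a b c. (a, b) \<in> green_H S \<longrightarrow> c \<in> carrier S \<longrightarrow> (c \<cdot> a, c \<cdot> b) \<in> green_H S)"
  unfolding left_cryptic_def left_congruence_def using equiv_green_H by blast

lemma right_cryptic_iff:
  "right_cryptic S \<longleftrightarrow> (\<forall>a b c. (a, b) \<in> green_H S \<longrightarrow> c \<in> carrier S \<longrightarrow> (a \<cdot> c, b \<cdot> c) \<in> green_H S)"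
  unfolding right_cryptic_def right_congruence_def using equiv_green_H by blast

lemma cryptic_iff: "cryptic S \<longleftrightarrow> left_cryptic S \<and> right_cryptic S"
proof
  assume c: "cryptic S"
  have "(c, c) \<in> green_H S" if "c \<in> carrier S" for c
    using that by (simp add: green_H_def green_L_def green_R_def)
  then show "left_cryptic S \<and> right_cryptic S"
    using c unfolding cryptic_def left_cryptic_def right_cryptic_def two_sided_congruence_def
      left_congruence_def right_congruence_def by blast
next
  assume "left_cryptic S \<and> right_cryptic S"
  then have l: "\<And>a b c. (a, b) \<in> green_H S \<Longrightarrow> c \<in> carrier S \<Longrightarrow> (c \<cdot> a, c \<cdot> b) \<in> green_H S"
    and r: "\<And>a b c. (a, b) \<in> green_H S \<Longrightarrow> c \<in> carrier S \<Longrightarrow> (a \<cdot> c, b \<cdot> c) \<in> green_H S"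
    unfolding left_cryptic_def right_cryptic_def left_congruence_def right_congruence_def by blast+
  have "(a \<cdot> c, b \<cdot> d) \<in> green_H S" if "(a, b) \<in> green_H S" "(c, d) \<in> green_H S" for a b c d
  proof -
    have "b \<in> carrier S" "c \<in> carrier S"
      using that green_H_carrier by blast+
    then have "(a \<cdot> c, b \<cdot> c) \<in> green_H S" "(b \<cdot> c, b \<cdot> d) \<in> green_H S" using that l r by blast+
    then show ?thesis using equiv_green_H by (meson equivE transD)
  qed
  then show "cryptic S"
    unfolding cryptic_def two_sided_congruence_def using equiv_green_H by blast
qed

end

section \<open>The semigroup T(S)\<close>

text \<open>For \<open>X\<close> a subset of \<open>S\<close>, the elements of \<open>T(S)\<close> with middle coordinate in \<open>X\<close>; with \<open>X\<close>
  the carrier of \<open>S\<close> these are all elements of \<open>T(S)\<close>.\<close>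

definition lift :: "('a, 'm) sgrp_scheme \<Rightarrow> 'a set \<Rightarrow> ('a \<times> 'a \<times> R2) set" where
  "lift S X = {(u \<cdot>\<^bsub>S\<^esub> t, t, \<alpha>) | u t \<alpha>. u \<in> carrier S \<and> t \<in> X}"

text \<open>The component of the right factor \<open>(s, t, \<beta>)\<close> by which a left factor with last coordinate
  \<open>\<alpha>\<close> is multiplied. Naming it treats both cases of the multiplication at once.\<close>

fun acting :: "R2 \<Rightarrow> 'a \<Rightarrow> 'a \<Rightarrow> 'a" where
  "acting Sigma s t = t"
| "acting Tau s t = s"

lemma TR2_mult_eq:
  "TR2_mult S (a, b, \<alpha>) (c, d, \<beta>) = (a \<cdot>\<^bsub>S\<^esub> acting \<alpha> c d, b \<cdot>\<^bsub>S\<^esub> acting \<alpha> c d, \<beta>)"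
  by (cases \<alpha>) auto

lemma T_mult [simp]:
  "(a, b, \<alpha>) \<cdot>\<^bsub>T_sgrp S\<^esub> (c, d, \<beta>) = (a \<cdot>\<^bsub>S\<^esub> acting \<alpha> c d, b \<cdot>\<^bsub>S\<^esub> acting \<alpha> c d, \<beta>)"
  unfolding T_sgrp_def by (simp add: TR2_mult_eq)

lemma TR2_mult_op [simp]: "x \<cdot>\<^bsub>TR2 S\<^esub> y = TR2_mult S x y"
  by (simp add: TR2_def)

context ic_sgrp
begin

lemma lift_iff: "(s, t, \<alpha>) \<in> lift S X \<longleftrightarrow> t \<in> X \<and> (\<exists>u\<in>carrier S. s = u \<cdot> t)"
  by (auto simp: lift_def)

lemma diagonal_in_lift: "X \<subseteq> carrier S \<Longrightarrow> t \<in> X \<Longrightarrow> (t, t, \<alpha>) \<in> lift S X"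
  unfolding lift_iff by (metis left_unit subsetD)

lemma lift_closed:
  assumes "x \<in> lift S (carrier S)" "y \<in> lift S (carrier S)"
  shows "TR2_mult S x y \<in> lift S (carrier S)"
proof -
  obtain u b \<alpha> where x: "x = (u \<cdot> b, b, \<alpha>)" "u \<in> carrier S" "b \<in> carrier S"
    using assms(1) by (auto simp: lift_def)
  obtain v d \<beta> where y: "y = (v \<cdot> d, d, \<beta>)" "v \<in> carrier S" "d \<in> carrier S"
    using assms(2) by (auto simp: lift_def)
  have "acting \<alpha> (v \<cdot> d) d \<in> carrier S" using y by (cases \<alpha>) (auto simp: mult_closed)
  then show ?thesis using x y by (auto simp: TR2_mult_eq lift_iff mult_assoc mult_closed)
qed

text \<open>The generators satisfy \<open>s \<in> S t\<close>, a condition closed under products. Conversely, with idempotents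
  \<open>f\<close> and \<open>e\<close> such that \<open>f t = t = t e\<close>,
  \<open>(u t, t, \<alpha>) = (u f, f, \<sigma>) (f, f, \<tau>) (t, e, \<sigma>) (e, e, \<alpha>)\<close>
  is a product of four generators. The middle two yield \<open>(t, t, \<sigma>)\<close>: the \<open>\<tau>\<close> picks the
  arbitrary element \<open>t\<close> out of the idempotent \<open>(t, e, \<sigma>)\<close>.\<close>

lemma carrier_T: "carrier (T_sgrp S) = lift S (carrier S)"
proof -
  have gens: "T_gens S = lift S (carrier S) \<inter> {x. TR2_mult S x x = x}"
    by (auto simp: T_gens_def idempotents_def TR2_def lift_def left_ideal_eq mult_closed)
  have "x \<in> lift S (carrier S)" if "x \<in> generated (TR2 S) (T_gens S)" for x
    using that by induction (auto simp: gens lift_closed)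
  moreover have "x \<in> generated (TR2 S) (T_gens S)" if "x \<in> lift S (carrier S)" for x
  proof -
    obtain u t \<alpha> where x: "x = (u \<cdot> t, t, \<alpha>)" "u \<in> carrier S" and t: "t \<in> carrier S"
      using \<open>x \<in> lift S (carrier S)\<close> by (auto simp: lift_def)
    obtain f where f: "f \<in> carrier S" "f \<cdot> f = f" "f \<cdot> t = t" using left_unit t by blast
    obtain e where e: "e \<in> carrier S" "e \<cdot> e = e" "t \<cdot> e = t" using right_unit t by blast
    have act: "acting \<alpha> e e = e" by (cases \<alpha>) auto
    have "(u \<cdot> f, f, Sigma) \<in> lift S (carrier S)" using f x(2) by (auto simp: lift_iff)
    moreover have "(f, f, Tau) \<in> lift S (carrier S)" "(e, e, \<alpha>) \<in> lift S (carrier S)"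
      using f e diagonal_in_lift by auto
    moreover have "(t, e, Sigma) \<in> lift S (carrier S)" using e t unfolding lift_iff by metis
    ultimately have "(u \<cdot> f, f, Sigma) \<in> T_gens S" "(f, f, Tau) \<in> T_gens S" "(t, e, Sigma) \<in> T_gens S"
      "(e, e, \<alpha>) \<in> T_gens S"
      unfolding gens using f e t x(2) by (auto simp: TR2_mult_eq act mult_assoc)
    note this[THEN generated.base]
    then have "TR2_mult S (TR2_mult S (u \<cdot> f, f, Sigma) (TR2_mult S (f, f, Tau) (t, e, Sigma)))
        (e, e, \<alpha>) \<in> generated (TR2 S) (T_gens S)"
      by (metis generated.step TR2_mult_op)
    then show ?thesis using x f e t by (simp add: mult_assoc mult_closed)
  qed
  ultimately show ?thesis by (auto simp: T_sgrp_def)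
qed

lemma acting_closed: "c \<in> carrier S \<Longrightarrow> d \<in> carrier S \<Longrightarrow> acting \<alpha> c d \<in> carrier S"
  by (cases \<alpha>) auto

lemma carrier_T_D:
  assumes "(s, t, \<alpha>) \<in> carrier (T_sgrp S)"
  shows "s \<in> carrier S" "t \<in> carrier S"
  using assms by (auto simp: carrier_T lift_iff mult_closed)

text \<open>An element \<open>(u t, t, \<alpha>)\<close> has the left identity \<open>(u f, f, \<sigma>)\<close> and the right identity
  \<open>(e, e, \<alpha>)\<close>, where \<open>f t = t = t e\<close>.\<close>

lemma ic_sgrp_T: "ic_sgrp (T_sgrp S)"
proof
  fix x y z
  assume x: "x \<in> carrier (T_sgrp S)" and y: "y \<in> carrier (T_sgrp S)"
  then show "x \<cdot>\<^bsub>T_sgrp S\<^esub> y \<in> carrier (T_sgrp S)"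
    using lift_closed unfolding carrier_T by (simp add: T_sgrp_def)
  assume z: "z \<in> carrier (T_sgrp S)"
  obtain a b \<alpha> c d \<beta> p q \<gamma> where eq: "x = (a, b, \<alpha>)" "y = (c, d, \<beta>)" "z = (p, q, \<gamma>)"
    by (metis prod_cases3)
  have "a \<in> carrier S" "b \<in> carrier S" "c \<in> carrier S" "d \<in> carrier S" "p \<in> carrier S" "q \<in> carrier S"
    using x y z carrier_T_D unfolding eq by metis+
  then show "x \<cdot>\<^bsub>T_sgrp S\<^esub> y \<cdot>\<^bsub>T_sgrp S\<^esub> z = x \<cdot>\<^bsub>T_sgrp S\<^esub> (y \<cdot>\<^bsub>T_sgrp S\<^esub> z)"
    unfolding eq by (cases \<alpha>) (simp_all add: mult_assoc acting_closed)
next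
  show "idempotent_covered (T_sgrp S)"
    unfolding idempotent_covered_def
  proof
    fix x assume "x \<in> carrier (T_sgrp S)"
    then obtain u t \<alpha> where x: "x = (u \<cdot> t, t, \<alpha>)" and u: "u \<in> carrier S" and t: "t \<in> carrier S"
      unfolding carrier_T by (auto simp: lift_def)
    obtain f where f: "f \<in> carrier S" "f \<cdot> f = f" "f \<cdot> t = t" using left_unit t by blast
    obtain e where e: "e \<in> carrier S" "e \<cdot> e = e" "t \<cdot> e = t" using right_unit t by blast
    have act: "acting \<beta> e e = e" for \<beta> by (cases \<beta>) auto
    have "(e, e, \<alpha>) \<in> idempotents (T_sgrp S)" "(u \<cdot> f, f, Sigma) \<in> idempotents (T_sgrp S)"
      unfolding idempotents_def carrier_T using u e f act
      by (auto simp: lift_iff mult_assoc intro: bexI[of _ e])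
    moreover have "x \<cdot>\<^bsub>T_sgrp S\<^esub> (e, e, \<alpha>) = x" "(u \<cdot> f, f, Sigma) \<cdot>\<^bsub>T_sgrp S\<^esub> x = x"
      unfolding x using u t e f act by (auto simp: mult_assoc)
    ultimately show "\<exists>e\<in>idempotents (T_sgrp S). \<exists>f\<in>idempotents (T_sgrp S).
        x \<cdot>\<^bsub>T_sgrp S\<^esub> e = x \<and> f \<cdot>\<^bsub>T_sgrp S\<^esub> x = x" by blast
  qed
qed

interpretation T: ic_sgrp "T_sgrp S" by (rule ic_sgrp_T)

text \<open>The multiplier \<open>(v x, x, \<sigma>)\<close> acts through \<open>t\<close> alone and leaves \<open>v\<close> free, which is why \<open>L\<close> does
  not see the first coordinate.\<close>

lemma T_left_mult:
  assumes "t \<in> carrier S" "s = u \<cdot> t" "u \<in> carrier S" "y = x \<cdot> t" "x \<in> carrier S" "v \<in> carrier S"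
  obtains z where "z \<in> carrier (T_sgrp S)" "(v \<cdot> y, y, \<alpha>) = z \<cdot>\<^bsub>T_sgrp S\<^esub> (s, t, \<alpha>)"
proof -
  have "(v \<cdot> x, x, Sigma) \<in> carrier (T_sgrp S)"
    using assms by (auto simp: carrier_T lift_iff)
  moreover have "(v \<cdot> y, y, \<alpha>) = (v \<cdot> x, x, Sigma) \<cdot>\<^bsub>T_sgrp S\<^esub> (s, t, \<alpha>)"
    using assms by (auto simp: mult_assoc)
  ultimately show ?thesis using that by blast
qed

text \<open>A left multiple of \<open>(s', t', \<beta>)\<close> keeps \<open>\<beta>\<close>, and its middle coordinate is a left multiple of \<open>t'\<close>
  or of \<open>s' \<in> S t'\<close>. By \<open>T_left_mult\<close> there is no further restriction.\<close>

lemma green_L_T: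
  "((s, t, \<alpha>), (s', t', \<beta>)) \<in> green_L (T_sgrp S) \<longleftrightarrow>
     (s, t, \<alpha>) \<in> carrier (T_sgrp S) \<and> (s', t', \<beta>) \<in> carrier (T_sgrp S)
     \<and> (t, t') \<in> green_L S \<and> \<alpha> = \<beta>"
proof -
  have fwd: "(\<exists>x\<in>carrier S. t = x \<cdot> t') \<and> \<alpha> = \<beta>"
    if st': "(s', t', \<beta>) \<in> carrier (T_sgrp S)" and "z \<in> carrier (T_sgrp S)"
      "(s, t, \<alpha>) = z \<cdot>\<^bsub>T_sgrp S\<^esub> (s', t', \<beta>)" for s t \<alpha> s' t' \<beta> z
  proof -
    obtain u where u: "u \<in> carrier S" "t' \<in> carrier S" "s' = u \<cdot> t'"
      using st' by (auto simp: carrier_T lift_iff)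
    obtain a b \<gamma> where z: "z = (a, b, \<gamma>)" by (metis prod_cases3)
    then have b: "b \<in> carrier S" using that(2) by (simp add: carrier_T lift_iff)
    have "t = b \<cdot> acting \<gamma> s' t'" "\<alpha> = \<beta>" using that(3) z by auto
    moreover have "b \<cdot> acting \<gamma> s' t' = b \<cdot> t' \<or> b \<cdot> acting \<gamma> s' t' = (b \<cdot> u) \<cdot> t'"
      using b u by (cases \<gamma>) (auto simp: mult_assoc)
    ultimately show ?thesis using b u mult_closed by metis
  qed
  have bwd: "\<exists>z\<in>carrier (T_sgrp S). (s, t, \<alpha>) = z \<cdot>\<^bsub>T_sgrp S\<^esub> (s', t', \<alpha>)"
    if st: "(s, t, \<alpha>) \<in> carrier (T_sgrp S)" and st': "(s', t', \<alpha>) \<in> carrier (T_sgrp S)"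
      and x: "x \<in> carrier S" "t = x \<cdot> t'" for s t \<alpha> s' t' x
  proof -
    obtain v where v: "v \<in> carrier S" "s = v \<cdot> t" using st by (auto simp: carrier_T lift_iff)
    obtain u where u: "u \<in> carrier S" "s' = u \<cdot> t'" "t' \<in> carrier S"
      using st' by (auto simp: carrier_T lift_iff)
    show ?thesis using T_left_mult[OF u(3,2,1) x(2,1) v(1)] v(2) by metis
  qed
  have car: "t \<in> carrier S" if "(s, t, \<alpha>) \<in> carrier (T_sgrp S)" for s t \<alpha>
    using that by (rule carrier_T_D)
  show ?thesis
  proof
    assume "((s, t, \<alpha>), (s', t', \<beta>)) \<in> green_L (T_sgrp S)"
    then have st: "(s, t, \<alpha>) \<in> carrier (T_sgrp S)" "(s', t', \<beta>) \<in> carrier (T_sgrp S)"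
      and x: "\<exists>z\<in>carrier (T_sgrp S). (s, t, \<alpha>) = z \<cdot>\<^bsub>T_sgrp S\<^esub> (s', t', \<beta>)"
      and y: "\<exists>z\<in>carrier (T_sgrp S). (s', t', \<beta>) = z \<cdot>\<^bsub>T_sgrp S\<^esub> (s, t, \<alpha>)"
      unfolding T.green_L_iff by blast+
    have "(\<exists>x\<in>carrier S. t = x \<cdot> t') \<and> \<alpha> = \<beta>" using x fwd[OF st(2)] by blast
    moreover have "\<exists>x\<in>carrier S. t' = x \<cdot> t" using y fwd[OF st(1)] by blast
    ultimately show "(s, t, \<alpha>) \<in> carrier (T_sgrp S) \<and> (s', t', \<beta>) \<in> carrier (T_sgrp S)
        \<and> (t, t') \<in> green_L S \<and> \<alpha> = \<beta>"
      using st car[OF st(1)] car[OF st(2)] by (simp add: green_L_iff)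
  next
    assume *: "(s, t, \<alpha>) \<in> carrier (T_sgrp S) \<and> (s', t', \<beta>) \<in> carrier (T_sgrp S)
        \<and> (t, t') \<in> green_L S \<and> \<alpha> = \<beta>"
    then obtain x y where "x \<in> carrier S" "t = x \<cdot> t'" "y \<in> carrier S" "t' = y \<cdot> t"
      unfolding green_L_iff by blast
    then show "((s, t, \<alpha>), (s', t', \<beta>)) \<in> green_L (T_sgrp S)"
      unfolding T.green_L_iff using * bwd[of s t \<alpha> s' t' x] bwd[of s' t' \<alpha> s t y] by blast
  qed
qed

text \<open>Right multiplication acts on both coordinates by the same element, so \<open>s = u t\<close> persists with
  the same \<open>u\<close>; the last coordinate can be changed at will.\<close>

lemma green_R_T:
  "((s, t, \<alpha>), (s', t', \<beta>)) \<in> green_R (T_sgrp S) \<longleftrightarrow>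
     (t, t') \<in> green_R S \<and> (\<exists>u\<in>carrier S. s = u \<cdot> t \<and> s' = u \<cdot> t')"
proof
  assume R: "((s, t, \<alpha>), (s', t', \<beta>)) \<in> green_R (T_sgrp S)"
  have fwd: "\<exists>x\<in>carrier S. s = s' \<cdot> x \<and> t = t' \<cdot> x"
    if "z \<in> carrier (T_sgrp S)" "(s, t, \<alpha>) = (s', t', \<beta>) \<cdot>\<^bsub>T_sgrp S\<^esub> z" for s t \<alpha> s' t' \<beta> z
  proof -
    obtain a b \<gamma> where z: "z = (a, b, \<gamma>)" by (metis prod_cases3)
    then have "a \<in> carrier S" "b \<in> carrier S"
      using that(1) carrier_T_D by metis+
    then show ?thesis using that(2) z acting_closed by auto
  qed
  have car: "(s, t, \<alpha>) \<in> carrier (T_sgrp S)" "(s', t', \<beta>) \<in> carrier (T_sgrp S)"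
    using R by (auto simp: T.green_R_iff)
  then obtain u where u: "u \<in> carrier S" "s = u \<cdot> t" "t \<in> carrier S" "t' \<in> carrier S"
    by (auto simp: carrier_T lift_iff)
  obtain x where x: "x \<in> carrier S" "s = s' \<cdot> x" "t = t' \<cdot> x"
    using R fwd unfolding T.green_R_iff by blast
  obtain y where y: "y \<in> carrier S" "s' = s \<cdot> y" "t' = t \<cdot> y"
    using R fwd unfolding T.green_R_iff by blast
  have "s' = u \<cdot> t'" using u y by (simp add: mult_assoc)
  moreover have "(t, t') \<in> green_R S" using u x y unfolding green_R_iff by blast
  ultimately show "(t, t') \<in> green_R S \<and> (\<exists>u\<in>carrier S. s = u \<cdot> t \<and> s' = u \<cdot> t')"
    using u by blast
next
  assume "(t, t') \<in> green_R S \<and> (\<exists>u\<in>carrier S. s = u \<cdot> t \<and> s' = u \<cdot> t')"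
  then obtain u x y where u: "u \<in> carrier S" "s = u \<cdot> t" "s' = u \<cdot> t'"
    and t: "t \<in> carrier S" "t' \<in> carrier S"
    and x: "x \<in> carrier S" "t = t' \<cdot> x" and y: "y \<in> carrier S" "t' = t \<cdot> y"
    unfolding green_R_iff by blast
  have act: "acting \<gamma> w w = w" for \<gamma> and w :: 'a by (cases \<gamma>) auto
  have "s = s' \<cdot> x" "s' = s \<cdot> y" using u t x y by (metis mult_assoc)+
  then have "(s, t, \<alpha>) = (s', t', \<beta>) \<cdot>\<^bsub>T_sgrp S\<^esub> (x, x, \<alpha>)"
    "(s', t', \<beta>) = (s, t, \<alpha>) \<cdot>\<^bsub>T_sgrp S\<^esub> (y, y, \<beta>)"
    using x y by (simp_all add: act)
  moreover have "(x, x, \<alpha>) \<in> carrier (T_sgrp S)" "(y, y, \<beta>) \<in> carrier (T_sgrp S)"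
    using diagonal_in_lift x y by (auto simp: carrier_T)
  moreover have "(s, t, \<alpha>) \<in> carrier (T_sgrp S)" "(s', t', \<beta>) \<in> carrier (T_sgrp S)"
    using u t by (auto simp: carrier_T lift_iff)
  ultimately show "((s, t, \<alpha>), (s', t', \<beta>)) \<in> green_R (T_sgrp S)"
    unfolding T.green_R_iff by blast
qed

lemma green_H_T:
  "((s, t, \<alpha>), (s', t', \<beta>)) \<in> green_H (T_sgrp S) \<longleftrightarrow>
     (t, t') \<in> green_H S \<and> \<alpha> = \<beta> \<and> (\<exists>u\<in>carrier S. s = u \<cdot> t \<and> s' = u \<cdot> t')"
  unfolding green_H_def by (auto simp: green_L_T green_R_T carrier_T lift_iff green_R_iff)

text \<open>Given \<open>t L q R t'\<close> and \<open>s' = u t'\<close>, the triple \<open>(u q, q, \<alpha>)\<close> is the required intermediate element,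
  since \<open>L\<close> does not constrain the first coordinate.\<close>

lemma green_D_T:
  "((s, t, \<alpha>), (s', t', \<beta>)) \<in> green_D (T_sgrp S) \<longleftrightarrow>
     (s, t, \<alpha>) \<in> carrier (T_sgrp S) \<and> (s', t', \<beta>) \<in> carrier (T_sgrp S) \<and> (t, t') \<in> green_D S"
  (is "?l \<longleftrightarrow> ?r")
proof
  assume ?l
  then obtain p q \<gamma> where L: "((s, t, \<alpha>), (p, q, \<gamma>)) \<in> green_L (T_sgrp S)"
    and R: "((p, q, \<gamma>), (s', t', \<beta>)) \<in> green_R (T_sgrp S)"
    unfolding green_D_def by auto
  have "(t, q) \<in> green_L S" "(q, t') \<in> green_R S" using L R by (simp_all add: green_L_T green_R_T)
  then have "(t, t') \<in> green_D S" unfolding green_D_def by blast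
  then show ?r using L R unfolding T.green_L_iff T.green_R_iff by blast
next
  assume r: ?r
  then obtain q where q: "(t, q) \<in> green_L S" "(q, t') \<in> green_R S" by (auto simp: green_D_def)
  obtain u where u: "u \<in> carrier S" "s' = u \<cdot> t'" using r by (auto simp: carrier_T lift_iff)
  have "((s, t, \<alpha>), (u \<cdot> q, q, \<alpha>)) \<in> green_L (T_sgrp S)"
    using r q u by (auto simp: green_L_T carrier_T lift_iff green_L_iff)
  moreover have "((u \<cdot> q, q, \<alpha>), (s', t', \<beta>)) \<in> green_R (T_sgrp S)"
    using q u by (auto simp: green_R_T)
  ultimately show ?l unfolding green_D_def by blast
qed

lemma principal_ideal_T:
  assumes st: "(s, t, \<alpha>) \<in> carrier (T_sgrp S)"
  shows "principal_ideal (T_sgrp S) (s, t, \<alpha>) = lift S (principal_ideal S t)"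
proof -
  obtain u where u: "u \<in> carrier S" "s = u \<cdot> t" and t: "t \<in> carrier S"
    using st by (auto simp: carrier_T lift_iff)
  have "(a, b, \<gamma>) \<in> lift S (principal_ideal S t)"
    if abg: "(a, b, \<gamma>) \<in> principal_ideal (T_sgrp S) (s, t, \<alpha>)" for a b \<gamma>
  proof -
    obtain x y where xy: "x \<in> carrier (T_sgrp S)" "y \<in> carrier (T_sgrp S)"
      and eq: "(a, b, \<gamma>) = x \<cdot>\<^bsub>T_sgrp S\<^esub> (s, t, \<alpha>) \<cdot>\<^bsub>T_sgrp S\<^esub> y"
      using abg unfolding T.principal_ideal_eq[OF st] by blast
    obtain c d \<delta> p q \<epsilon> where z: "x = (c, d, \<delta>)" "y = (p, q, \<epsilon>)" by (metis prod_cases3)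
    have d: "d \<in> carrier S" "p \<in> carrier S" "q \<in> carrier S"
      using xy carrier_T_D unfolding z by metis+
    have "b = d \<cdot> acting \<delta> s t \<cdot> acting \<alpha> p q" using eq z by simp
    moreover have "acting \<delta> s t \<in> principal_ideal S t"
      using principal_ideal_refl principal_ideal_closed(2) t u by (cases \<delta>) auto
    ultimately have "b \<in> principal_ideal S t"
      using principal_ideal_closed(2,3)[OF t] d acting_closed by blast
    moreover have "(a, b, \<gamma>) \<in> carrier (T_sgrp S)" using T.principal_ideal_closed(1)[OF st abg st] .
    ultimately show ?thesis by (auto simp: carrier_T lift_iff)
  qed
  moreover have "(v \<cdot> b, b, \<gamma>) \<in> principal_ideal (T_sgrp S) (s, t, \<alpha>)"
    if v: "v \<in> carrier S" and b: "b \<in> principal_ideal S t" for v b \<gamma>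
  proof -
    obtain x y where xy: "x \<in> carrier S" "y \<in> carrier S" "b = x \<cdot> t \<cdot> y"
      using b unfolding principal_ideal_eq[OF t] by blast
    have act: "acting \<alpha> y y = y" by (cases \<alpha>) auto
    have "(v \<cdot> x, x, Sigma) \<in> carrier (T_sgrp S)" "(y, y, \<gamma>) \<in> carrier (T_sgrp S)"
      using xy v diagonal_in_lift by (auto simp: carrier_T lift_iff)
    moreover have "(v \<cdot> b, b, \<gamma>)
        = (v \<cdot> x, x, Sigma) \<cdot>\<^bsub>T_sgrp S\<^esub> (s, t, \<alpha>) \<cdot>\<^bsub>T_sgrp S\<^esub> (y, y, \<gamma>)"
      using xy v t u by (simp add: act mult_assoc mult_closed)
    ultimately show ?thesis unfolding T.principal_ideal_eq[OF st] by blast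
  qed
  ultimately show ?thesis by (auto simp: lift_def)
qed

lemma green_J_T:
  "((s, t, \<alpha>), (s', t', \<beta>)) \<in> green_J (T_sgrp S) \<longleftrightarrow>
     (s, t, \<alpha>) \<in> carrier (T_sgrp S) \<and> (s', t', \<beta>) \<in> carrier (T_sgrp S) \<and> (t, t') \<in> green_J S"
proof -
  have "(s', t', \<beta>) \<in> principal_ideal (T_sgrp S) (s, t, \<alpha>) \<longleftrightarrow> t' \<in> principal_ideal S t"
    if "(s, t, \<alpha>) \<in> carrier (T_sgrp S)" "(s', t', \<beta>) \<in> carrier (T_sgrp S)" for s t \<alpha> s' t' \<beta>
    using that(2) unfolding principal_ideal_T[OF that(1)] by (simp add: carrier_T lift_iff)
  then show ?thesis unfolding T.green_J_iff green_J_iff using carrier_T_D(2) by metis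
qed

lemma J_class_T:
  assumes "(s, t, \<alpha>) \<in> carrier (T_sgrp S)"
  shows "J_class (T_sgrp S) (s, t, \<alpha>) = lift S (J_class S t)"
proof -
  have "x \<in> J_class (T_sgrp S) (s, t, \<alpha>) \<longleftrightarrow> x \<in> lift S (J_class S t)" for x
  proof -
    obtain a b \<beta> where x: "x = (a, b, \<beta>)" by (metis prod_cases3)
    have "b \<in> carrier S" if "(t, b) \<in> green_J S" using that by (simp add: green_J_def)
    then show ?thesis
      using assms unfolding x T.mem_J_class green_J_T lift_iff mem_J_class carrier_T by blast
  qed
  then show ?thesis by blast
qed

section \<open>Transfer of the properties\<close>

text \<open>The classes of \<open>r'\<close> are the images of those of \<open>r\<close> under \<open>lift S\<close>, and \<open>lift S\<close> is injective
  because a set of middle coordinates can be read off its lift. The lemma serves \<open>J\<close> and \<open>D\<close>.\<close>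

lemma singleton_quotient_T:
  assumes r: "r \<subseteq> carrier S \<times> carrier S"
    and r': "\<And>s t \<alpha> s' t' \<beta>. ((s, t, \<alpha>), (s', t', \<beta>)) \<in> r' \<longleftrightarrow>
      (s, t, \<alpha>) \<in> carrier (T_sgrp S) \<and> (s', t', \<beta>) \<in> carrier (T_sgrp S) \<and> (t, t') \<in> r"
  shows "is_singleton (carrier (T_sgrp S) // r') \<longleftrightarrow> is_singleton (carrier S // r)"
proof -
  have cls: "r' `` {(s, t, \<alpha>)} = lift S (r `` {t})" if "(s, t, \<alpha>) \<in> carrier (T_sgrp S)" for s t \<alpha>
  proof -
    have "x \<in> r' `` {(s, t, \<alpha>)} \<longleftrightarrow> x \<in> lift S (r `` {t})" for x
    proof -
      obtain a b \<beta> where x: "x = (a, b, \<beta>)" by (metis prod_cases3)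
      have "b \<in> carrier S" if "(t, b) \<in> r" using that r by blast
      then show ?thesis
        using that unfolding x Image_singleton_iff r' lift_iff carrier_T by blast
    qed
    then show ?thesis by blast
  qed
  have "carrier (T_sgrp S) // r' = lift S ` (carrier S // r)"
  proof
    show "carrier (T_sgrp S) // r' \<subseteq> lift S ` (carrier S // r)"
    proof
      fix C assume "C \<in> carrier (T_sgrp S) // r'"
      then obtain s t \<alpha> where "(s, t, \<alpha>) \<in> carrier (T_sgrp S)" "C = r' `` {(s, t, \<alpha>)}"
        by (auto elim: quotientE)
      then show "C \<in> lift S ` (carrier S // r)"
        using cls carrier_T_D(2) quotientI[of t "carrier S" r] by auto
    qed
    show "lift S ` (carrier S // r) \<subseteq> carrier (T_sgrp S) // r'"
    proof
      fix C assume "C \<in> lift S ` (carrier S // r)"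
      then obtain t where t: "t \<in> carrier S" "C = lift S (r `` {t})" by (auto elim: quotientE)
      then have "(t, t, Sigma) \<in> carrier (T_sgrp S)" using diagonal_in_lift by (auto simp: carrier_T)
      then show "C \<in> carrier (T_sgrp S) // r'" using cls t quotientI by metis
    qed
  qed
  moreover have "inj_on (lift S) (carrier S // r)"
  proof (rule inj_onI)
    have sub: "X \<subseteq> carrier S" if "X \<in> carrier S // r" for X using that r by (auto elim!: quotientE)
    have proj: "X = (\<lambda>(s, t, \<alpha>). t) ` lift S X" if "X \<subseteq> carrier S" for X
    proof -
      have "t \<in> (\<lambda>(s, t, \<alpha>). t) ` lift S X" if "t \<in> X" for t
        using diagonal_in_lift[OF \<open>X \<subseteq> carrier S\<close> that, of Sigma] by force
      then show ?thesis by (auto simp: lift_iff)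
    qed
    fix X Y assume "X \<in> carrier S // r" "Y \<in> carrier S // r" "lift S X = lift S Y"
    then show "X = Y" using sub proj by metis
  qed
  ultimately show ?thesis by (simp add: is_singleton_altdef card_image)
qed

lemma simple_T: "simple_sgrp (T_sgrp S) \<longleftrightarrow> simple_sgrp S"
  unfolding simple_sgrp_def
proof (rule singleton_quotient_T)
  show "green_J S \<subseteq> carrier S \<times> carrier S" by (auto simp: green_J_def)
qed (rule green_J_T)

lemma bisimple_T: "bisimple (T_sgrp S) \<longleftrightarrow> bisimple S"
  unfolding bisimple_def
proof (rule singleton_quotient_T)
  show "green_D S \<subseteq> carrier S \<times> carrier S" by (auto simp: green_D_def green_L_def green_R_def)
qed (rule green_D_T)

text \<open>Upwards, \<open>(e, e, \<sigma>)\<close> inherits minimality from \<open>e\<close>, since an idempotent below it has the form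
  \<open>(b, b, \<sigma>)\<close>. Downwards, the idempotents of \<open>T(S)\<close> are of two kinds. In \<open>(a, b, \<sigma>)\<close> the
  element \<open>b\<close> is idempotent, and an idempotent \<open>f\<close> below \<open>b\<close> gives \<open>(a f, f, \<sigma>)\<close> below
  \<open>(a, b, \<sigma>)\<close>. In \<open>(a, b, \<tau>)\<close> the element \<open>a\<close> is idempotent with \<open>a L b\<close>, and an idempotent
  \<open>f\<close> below \<open>a\<close> gives \<open>(f, b f, \<tau>)\<close> below \<open>(a, b, \<tau>)\<close>. In this second case \<open>a\<close> and \<open>b f\<close> are
  known to be in \<open>X\<close> only up to \<open>L\<close>, whence the saturation hypothesis, which holds for
  \<open>J\<close>-classes.\<close>

lemma primitive_in_T:
  assumes X: "X \<subseteq> carrier S"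
    and sat: "\<And>x y. x \<in> X \<Longrightarrow> (x, y) \<in> green_L S \<Longrightarrow> y \<in> X"
  shows "(\<exists>e. primitive_in (T_sgrp S) (lift S X) e) \<longleftrightarrow> (\<exists>e. primitive_in S X e)"
proof
  assume "\<exists>e. primitive_in S X e"
  then obtain e where e: "e \<in> X" "e \<cdot> e = e"
    and prim: "\<And>f. f \<in> X \<Longrightarrow> f \<cdot> f = f \<Longrightarrow> e \<cdot> f = f \<Longrightarrow> f \<cdot> e = f \<Longrightarrow> e = f"
    by (auto simp: primitive_in_def)
  have "(e, e, Sigma) = x"
    if "x \<in> lift S X" "x \<cdot>\<^bsub>T_sgrp S\<^esub> x = x" "(e, e, Sigma) \<cdot>\<^bsub>T_sgrp S\<^esub> x = x"
      "x \<cdot>\<^bsub>T_sgrp S\<^esub> (e, e, Sigma) = x" for x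
  proof -
    obtain a b \<beta> where x: "x = (a, b, \<beta>)" by (metis prod_cases3)
    have "\<beta> = Sigma" "a = b" "e \<cdot> b = b" using that(3,4) x by auto
    moreover have "b \<in> X" "b \<cdot> b = b" "b \<cdot> e = b"
      using that calculation x by (auto simp: lift_iff)
    ultimately show ?thesis using prim x by simp
  qed
  then have "primitive_in (T_sgrp S) (lift S X) (e, e, Sigma)"
    using e diagonal_in_lift[OF X] by (auto simp: primitive_in_def)
  then show "\<exists>e. primitive_in (T_sgrp S) (lift S X) e" by blast
next
  assume "\<exists>e. primitive_in (T_sgrp S) (lift S X) e"
  then obtain a b \<alpha> where ab: "(a, b, \<alpha>) \<in> lift S X"
    "(a, b, \<alpha>) \<cdot>\<^bsub>T_sgrp S\<^esub> (a, b, \<alpha>) = (a, b, \<alpha>)"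
    and prim: "\<And>x. x \<in> lift S X \<Longrightarrow> x \<cdot>\<^bsub>T_sgrp S\<^esub> x = x \<Longrightarrow> (a, b, \<alpha>) \<cdot>\<^bsub>T_sgrp S\<^esub> x = x
      \<Longrightarrow> x \<cdot>\<^bsub>T_sgrp S\<^esub> (a, b, \<alpha>) = x \<Longrightarrow> (a, b, \<alpha>) = x"
    by (auto simp: primitive_in_def)
  obtain u where u: "u \<in> carrier S" "a = u \<cdot> b" and b: "b \<in> X" "b \<in> carrier S"
    using ab(1) X by (auto simp: lift_iff)
  then have a: "a \<in> carrier S" by (simp add: mult_closed)
  show "\<exists>e. primitive_in S X e"
  proof (cases \<alpha>)
    case Sigma
    then have idem: "b \<cdot> b = b" "a \<cdot> b = a" using ab by auto
    have "b = f" if f: "f \<in> X" "f \<cdot> f = f" "b \<cdot> f = f" "f \<cdot> b = f" for f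
    proof -
      have fc: "f \<in> carrier S" using f X by auto
      have "(a, b, \<alpha>) = (a \<cdot> f, f, Sigma)"
        using prim[of "(a \<cdot> f, f, Sigma)"] f fc a b Sigma by (auto simp: lift_iff mult_assoc)
      then show ?thesis by simp
    qed
    then show ?thesis using b idem unfolding primitive_in_def by blast
  next
    case Tau
    then have idem: "a \<cdot> a = a" "b \<cdot> a = b" using ab by auto
    have "(b, a) \<in> green_L S" using a b u idem(2) unfolding green_L_iff by metis
    then have "a \<in> X" using sat b by blast
    moreover have "a = f" if f: "f \<in> X" "f \<cdot> f = f" "a \<cdot> f = f" "f \<cdot> a = f" for f
    proof -
      have fc: "f \<in> carrier S" using f X by auto
      have uf: "f = u \<cdot> (b \<cdot> f)" using f fc u b by (metis mult_assoc)
      then have "(f, b \<cdot> f) \<in> green_L S"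
        unfolding green_L_iff using fc b u mult_closed by blast
      then have "b \<cdot> f \<in> X" using sat f by blast
      then have "(f, b \<cdot> f, Tau) \<in> lift S X" using uf u unfolding lift_iff by blast
      then have "(a, b, \<alpha>) = (f, b \<cdot> f, Tau)"
        using prim[of "(f, b \<cdot> f, Tau)"] f fc a b Tau by (auto simp: mult_assoc)
      then show ?thesis by simp
    qed
    ultimately show ?thesis using idem unfolding primitive_in_def by blast
  qed
qed

lemma completely_simple_T: "completely_simple (T_sgrp S) \<longleftrightarrow> completely_simple S"
  unfolding completely_simple_iff T.completely_simple_iff simple_T unfolding carrier_T
  using primitive_in_T[of "carrier S"] by (auto simp: green_L_def)

lemma all_carrier_T:
  assumes "\<And>s t \<alpha>. (s, t, \<alpha>) \<in> carrier (T_sgrp S) \<Longrightarrow> P (s, t, \<alpha>) \<longleftrightarrow> Q t"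
  shows "(\<forall>x\<in>carrier (T_sgrp S). P x) \<longleftrightarrow> (\<forall>t\<in>carrier S. Q t)"
proof
  assume P: "\<forall>x\<in>carrier (T_sgrp S). P x"
  show "\<forall>t\<in>carrier S. Q t"
  proof
    fix t assume "t \<in> carrier S"
    then have "(t, t, Sigma) \<in> carrier (T_sgrp S)" by (simp add: carrier_T diagonal_in_lift)
    then show "Q t" using P assms by blast
  qed
next
  assume Q: "\<forall>t\<in>carrier S. Q t"
  then show "\<forall>x\<in>carrier (T_sgrp S). P x"
    using assms carrier_T_D(2) by (metis prod_cases3)
qed

lemma completely_semisimple_T: "completely_semisimple (T_sgrp S) \<longleftrightarrow> completely_semisimple S"
  unfolding completely_semisimple_def
proof (rule all_carrier_T)
  fix s t \<alpha> assume st: "(s, t, \<alpha>) \<in> carrier (T_sgrp S)"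
  then have t: "t \<in> carrier S" by (simp add: carrier_T lift_iff)
  have "J_class S t \<subseteq> carrier S" by (auto simp: mem_J_class green_J_def)
  moreover have "y \<in> J_class S t" if "x \<in> J_class S t" "(x, y) \<in> green_L S" for x y
    using that green_L_subset_J unfolding mem_J_class by (auto simp: green_J_def)
  ultimately show "completely_zero_simple (principal_factor (T_sgrp S) (s, t, \<alpha>))
      \<longleftrightarrow> completely_zero_simple (principal_factor S t)"
    using primitive_in_T[of "J_class S t"] st t
    by (simp add: completely_zero_simple_principal_factor_iff
        T.completely_zero_simple_principal_factor_iff J_class_T)
qed

text \<open>Suppose a product of \<open>(a, b, \<alpha>)\<close> and \<open>(c, d, \<beta>)\<close> has its middle coordinate \<open>b x\<close> in the \<open>J\<close>-class
  containing \<open>b\<close> and \<open>d\<close>, with \<open>x\<close> being \<open>c\<close> or \<open>d\<close>. Then \<open>x\<close> is below \<open>d\<close> and above \<open>b x\<close>, so it belongs to that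
  class, and \<open>b\<close>, \<open>x\<close> witness the condition in \<open>S\<close>.\<close>

lemma semisimple_T: "semisimple (T_sgrp S) \<longleftrightarrow> semisimple S"
  unfolding semisimple_def
proof (rule all_carrier_T)
  fix s t \<alpha> assume st: "(s, t, \<alpha>) \<in> carrier (T_sgrp S)"
  then have t: "t \<in> carrier S" by (simp add: carrier_T lift_iff)
  let ?J = "J_class S t"
  have J: "?J \<subseteq> carrier S" by (auto simp: mem_J_class green_J_def)
  have "(\<exists>x\<in>lift S ?J. \<exists>y\<in>lift S ?J. x \<cdot>\<^bsub>T_sgrp S\<^esub> y \<in> lift S ?J)
      \<longleftrightarrow> (\<exists>x\<in>?J. \<exists>y\<in>?J. x \<cdot> y \<in> ?J)"
  proof
    assume "\<exists>x\<in>?J. \<exists>y\<in>?J. x \<cdot> y \<in> ?J"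
    then obtain x y where xy: "x \<in> ?J" "y \<in> ?J" "x \<cdot> y \<in> ?J" by blast
    then show "\<exists>x\<in>lift S ?J. \<exists>y\<in>lift S ?J. x \<cdot>\<^bsub>T_sgrp S\<^esub> y \<in> lift S ?J"
      using diagonal_in_lift[OF J, of _ Sigma]
      by (intro bexI[of _ "(x, x, Sigma)"] bexI[of _ "(y, y, Sigma)"]) auto
  next
    assume "\<exists>x\<in>lift S ?J. \<exists>y\<in>lift S ?J. x \<cdot>\<^bsub>T_sgrp S\<^esub> y \<in> lift S ?J"
    then obtain a b \<alpha> c d \<beta> where "(a, b, \<alpha>) \<in> lift S ?J" and cd: "(c, d, \<beta>) \<in> lift S ?J"
      and "(a, b, \<alpha>) \<cdot>\<^bsub>T_sgrp S\<^esub> (c, d, \<beta>) \<in> lift S ?J" by (metis prod_cases3)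
    then have b: "b \<in> ?J" and d: "d \<in> ?J" and p: "b \<cdot> acting \<alpha> c d \<in> ?J" by (auto simp: lift_iff)
    obtain u where u: "u \<in> carrier S" "c = u \<cdot> d" using cd by (auto simp: lift_iff)
    have car: "b \<in> carrier S" "d \<in> carrier S" "acting \<alpha> c d \<in> carrier S"
      using b d u J acting_closed mult_closed by blast+
    have "acting \<alpha> c d \<in> principal_ideal S d"
      using u car principal_ideal_refl principal_ideal_closed(2) by (cases \<alpha>) auto
    moreover have "b \<cdot> acting \<alpha> c d \<in> principal_ideal S (acting \<alpha> c d)"
      using car principal_ideal_refl principal_ideal_closed(2) by blast
    ultimately have "acting \<alpha> c d \<in> ?J"
      using J_class_divisor[OF t car(3) d p] by blast
    then show "\<exists>x\<in>?J. \<exists>y\<in>?J. x \<cdot> y \<in> ?J" using b p by blast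
  qed
  then show "zero_simple (principal_factor (T_sgrp S) (s, t, \<alpha>)) \<longleftrightarrow> zero_simple (principal_factor S t)"
    using st t by (simp add: zero_simple_principal_factor_iff
        T.zero_simple_principal_factor_iff J_class_T)
qed

text \<open>\<open>R\<close>-related elements share their left identities, which supplies the common \<open>u\<close> of
  \<open>green_H_T\<close>.\<close>

lemma green_H_diagonal:
  "(a, b) \<in> green_H S \<longleftrightarrow> ((a, a, \<alpha>), (b, b, \<alpha>)) \<in> green_H (T_sgrp S)"
proof -
  have "\<exists>u\<in>carrier S. a = u \<cdot> a \<and> b = u \<cdot> b" if ab: "(a, b) \<in> green_H S"
  proof -
    obtain x where x: "x \<in> carrier S" "b = a \<cdot> x" and a: "a \<in> carrier S"
      using ab by (auto simp: green_H_def green_R_iff)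
    obtain f where "f \<in> carrier S" "f \<cdot> a = a" using left_unit a by blast
    then show ?thesis using x a by (metis mult_assoc)
  qed
  then show ?thesis by (auto simp: green_H_T)
qed

lemma left_cryptic_T: "left_cryptic (T_sgrp S) \<longleftrightarrow> left_cryptic S"
proof
  assume l: "left_cryptic (T_sgrp S)"
  show "left_cryptic S"
    unfolding left_cryptic_iff
  proof (intro allI impI)
    fix a b c assume ab: "(a, b) \<in> green_H S" and c: "c \<in> carrier S"
    have "((c, c, Sigma) \<cdot>\<^bsub>T_sgrp S\<^esub> (a, a, Sigma), (c, c, Sigma) \<cdot>\<^bsub>T_sgrp S\<^esub> (b, b, Sigma))
        \<in> green_H (T_sgrp S)"
      using l ab c green_H_diagonal diagonal_in_lift unfolding T.left_cryptic_iff carrier_T by blast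
    then show "(c \<cdot> a, c \<cdot> b) \<in> green_H S" using green_H_diagonal by simp
  qed
next
  assume l: "left_cryptic S"
  show "left_cryptic (T_sgrp S)"
    unfolding T.left_cryptic_iff
  proof (intro allI impI)
    fix x y z assume xy: "(x, y) \<in> green_H (T_sgrp S)" and z: "z \<in> carrier (T_sgrp S)"
    obtain w d \<gamma> where zz: "z = (w \<cdot> d, d, \<gamma>)" "w \<in> carrier S" "d \<in> carrier S"
      using z by (auto simp: carrier_T lift_def)
    obtain u t t' \<alpha> where x: "x = (u \<cdot> t, t, \<alpha>)" and y: "y = (u \<cdot> t', t', \<alpha>)"
      and u: "u \<in> carrier S" and t: "(t, t') \<in> green_H S"
      using xy by (cases x; cases y) (auto simp: green_H_T)
    \<comment> \<open>The element by which left multiplication with \<open>z\<close> acts on the middle coordinate; with \<open>\<tau>\<close> it passes through \<open>u t\<close>.\<close>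
    define v where "v = (case \<gamma> of Sigma \<Rightarrow> d | Tau \<Rightarrow> d \<cdot> u)"
    have v: "v \<in> carrier S" using zz u by (cases \<gamma>) (auto simp: v_def mult_closed)
    have "t \<in> carrier S" "t' \<in> carrier S" using t green_H_carrier by blast+
    then have eq: "z \<cdot>\<^bsub>T_sgrp S\<^esub> x = (w \<cdot> (v \<cdot> t), v \<cdot> t, \<alpha>)"
      "z \<cdot>\<^bsub>T_sgrp S\<^esub> y = (w \<cdot> (v \<cdot> t'), v \<cdot> t', \<alpha>)"
      using zz u by (cases \<gamma>; simp add: x y v_def mult_assoc mult_closed)+
    have "(v \<cdot> t, v \<cdot> t') \<in> green_H S" using l t v unfolding left_cryptic_iff by blast
    then show "(z \<cdot>\<^bsub>T_sgrp S\<^esub> x, z \<cdot>\<^bsub>T_sgrp S\<^esub> y) \<in> green_H (T_sgrp S)"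
      unfolding eq green_H_T using zz(2) by blast
  qed
qed

lemma right_cryptic_T: "right_cryptic (T_sgrp S) \<longleftrightarrow> right_cryptic S"
proof
  assume l: "right_cryptic (T_sgrp S)"
  show "right_cryptic S"
    unfolding right_cryptic_iff
  proof (intro allI impI)
    fix a b c assume ab: "(a, b) \<in> green_H S" and c: "c \<in> carrier S"
    have "((a, a, Sigma) \<cdot>\<^bsub>T_sgrp S\<^esub> (c, c, Sigma), (b, b, Sigma) \<cdot>\<^bsub>T_sgrp S\<^esub> (c, c, Sigma))
        \<in> green_H (T_sgrp S)"
      using l ab c green_H_diagonal diagonal_in_lift unfolding T.right_cryptic_iff carrier_T by blast
    then show "(a \<cdot> c, b \<cdot> c) \<in> green_H S" using green_H_diagonal by simp
  qed
next
  assume r: "right_cryptic S"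
  show "right_cryptic (T_sgrp S)"
    unfolding T.right_cryptic_iff
  proof (intro allI impI)
    fix x y z assume xy: "(x, y) \<in> green_H (T_sgrp S)" and z: "z \<in> carrier (T_sgrp S)"
    obtain c d \<gamma> where zz: "z = (c, d, \<gamma>)" by (metis prod_cases3)
    obtain u t t' \<alpha> where x: "x = (u \<cdot> t, t, \<alpha>)" and y: "y = (u \<cdot> t', t', \<alpha>)"
      and u: "u \<in> carrier S" and t: "(t, t') \<in> green_H S"
      using xy by (cases x; cases y) (auto simp: green_H_T)
    define p where "p = acting \<alpha> c d"
    have p: "p \<in> carrier S"
      using z acting_closed carrier_T_D unfolding zz p_def by metis
    have "t \<in> carrier S" "t' \<in> carrier S" using t green_H_carrier by blast+
    then have eq: "x \<cdot>\<^bsub>T_sgrp S\<^esub> z = (u \<cdot> (t \<cdot> p), t \<cdot> p, \<gamma>)"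
      "y \<cdot>\<^bsub>T_sgrp S\<^esub> z = (u \<cdot> (t' \<cdot> p), t' \<cdot> p, \<gamma>)"
      using zz u p by (simp_all add: x y p_def[symmetric] mult_assoc)
    have "(t \<cdot> p, t' \<cdot> p) \<in> green_H S" using r t p unfolding right_cryptic_iff by blast
    then show "(x \<cdot>\<^bsub>T_sgrp S\<^esub> z, y \<cdot>\<^bsub>T_sgrp S\<^esub> z) \<in> green_H (T_sgrp S)"
      unfolding eq green_H_T using u by blast
  qed
qed

lemma cryptic_T: "cryptic (T_sgrp S) \<longleftrightarrow> cryptic S"
  by (simp add: cryptic_iff T.cryptic_iff left_cryptic_T right_cryptic_T)

end

theorem proposition4p8:
  fixes S :: "'a sgrp"
  assumes "sgrp S"
    and "idempotent_covered S"
  shows "(simple_sgrp S \<longleftrightarrow> simple_sgrp (T_sgrp S))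
    \<and> (bisimple S \<longleftrightarrow> bisimple (T_sgrp S))
    \<and> (completely_simple S \<longleftrightarrow> completely_simple (T_sgrp S))
    \<and> (semisimple S \<longleftrightarrow> semisimple (T_sgrp S))
    \<and> (completely_semisimple S \<longleftrightarrow> completely_semisimple (T_sgrp S))
    \<and> (cryptic S \<longleftrightarrow> cryptic (T_sgrp S))
    \<and> (left_cryptic S \<longleftrightarrow> left_cryptic (T_sgrp S))
    \<and> (right_cryptic S \<longleftrightarrow> right_cryptic (T_sgrp S))"
proof -
  interpret ic_sgrp S
    using assms by (simp add: ic_sgrp_def ic_sgrp_axioms_def)
  show ?thesis
    by (simp add: simple_T bisimple_T completely_simple_T semisimple_T completely_semisimple_T
        cryptic_T left_cryptic_T right_cryptic_T)
qed

end
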